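(* For all non-negative integers $n,k,\ell,j$ with $0\le j\le \ell$, there exists a bijection from $\mathcal{W}(n,k,\ell,j)$ to $\mathcal{A}(n,k,\ell,j)$; in particular these two finite sets have the same cardinality.
   Context: Words are over the alphabet $\{x,y,z\}$. Let $\mathcal{W}$ be the set of words that are empty or end with $x$ or $z$. For $u=u_1\cdots u_m$ define the weight $\omega(u)=\sum_{i=1}^m \chi(u_i\ne y)\,(i+|\{j\le i: u_j=z\}|)$, where $\chi(S)$ is $1$ if $S$ holds and $0$ otherwise. In a word $u$, a letter $u_i=z$ is called odd (resp. even) if the number of indices $t<i$ such that $u_t$ is $y$ or is an odd $z$ is odd (resp. even) (this defines parity recursively from left to right). $\mathcal{W}(n,k,\ell,j)$ is the set of words in $\mathcal{W}$ of weight $n$ with exactly $k$ letters $x$, exactly $\ell$ letters $z$, exactly $j$ of which are odd. A two-color partition is a partition each of whose parts is colored red or green. $\mathcal{A}(n,k,\ell,j)$ is the set of two-color partitions of $n$ consisting of $k+j$ pairwise distinct red parts and $\ell$ pairwise distinct even green parts, such that exactly $k$ red parts are larger than $\ell$ (so exactly $j$ red parts are at most $\ell$). *)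

theory Defs
  imports "HOL-Library.Multiset"
begin

text \<open>
  Words are lists, so positions are counted from 0: the letter \<open>u\<^sub>i\<close> with \<open>i \<ge> 1\<close> is \<open>u ! (i - 1)\<close>.
\<close>

datatype letter = X | Y | Z

definition words :: "letter list set" where
  "words = {u. u = [] \<or> last u = X \<or> last u = Z}"

text \<open>\<open>Suc i\<close> is the position, counted from 1, of the letter \<open>u ! i\<close>.\<close>

definition weight :: "letter list \<Rightarrow> nat" where
  "weight u = (\<Sum>i<length u. if u ! i \<noteq> Y then Suc i + card {t. t \<le> i \<and> u ! t = Z} else 0)"

context
  notes conj_cong [fundef_cong] Collect_cong [fundef_cong]
begin

fun odd_z :: "letter list \<Rightarrow> nat \<Rightarrow> bool" where
  "odd_z u i \<longleftrightarrow> u ! i = Z \<and> odd (card {t. t < i \<and> (u ! t = Y \<or> odd_z u t)})"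

end

text \<open>The defining equation unfolds indefinitely as a rewrite rule.\<close>

declare odd_z.simps [simp del]

definition \<W> :: "nat \<Rightarrow> nat \<Rightarrow> nat \<Rightarrow> nat \<Rightarrow> letter list set" where
  "\<W> n k l j = {u \<in> words. weight u = n \<and> count_list u X = k \<and> count_list u Z = l \<and>
     card {i. i < length u \<and> odd_z u i} = j}"

datatype color = Red | Green

text \<open>A colored part is a pair of its size and its color.\<close>

definition two_color_partitions :: "nat \<Rightarrow> (nat \<times> color) multiset set" where
  "two_color_partitions n = {P. (\<forall>p \<in># P. fst p > 0) \<and> (\<Sum>p \<in># P. fst p) = n}"

definition parts_of_color :: "color \<Rightarrow> (nat \<times> color) multiset \<Rightarrow> nat multiset" where
  "parts_of_color c P = image_mset fst (filter_mset (\<lambda>p. snd p = c) P)"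

definition pairwise_distinct :: "nat multiset \<Rightarrow> bool" where
  "pairwise_distinct M \<longleftrightarrow> (\<forall>a \<in># M. count M a = 1)"

definition \<A> :: "nat \<Rightarrow> nat \<Rightarrow> nat \<Rightarrow> nat \<Rightarrow> (nat \<times> color) multiset set" where
  "\<A> n k l j = {P \<in> two_color_partitions n.
     size (parts_of_color Red P) = k + j \<and> pairwise_distinct (parts_of_color Red P) \<and>
     size (parts_of_color Green P) = l \<and> pairwise_distinct (parts_of_color Green P) \<and>
     (\<forall>a \<in># parts_of_color Green P. even a) \<and>
     size {#a \<in># parts_of_color Red P. a > l#} = k}"

end

theory Submission
  imports Defs
begin

text \<open>
  Let \<open>u\<close> have \<open>\<ell>\<close> letters \<open>z\<close>, and delete its letters \<open>x\<close> from right to left. Deleting the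
  \<open>x\<close> at position \<open>p\<close> lowers the weight by \<open>p\<close>, plus one for each preceding \<open>z\<close>, plus one for each
  following \<open>z\<close> (which moves left): by \<open>p + \<ell>\<close> in total. As a word may be thought of as continued by
  infinitely many \<open>y\<close>, these are \<open>k\<close> arbitrary distinct numbers above \<open>\<ell>\<close>: the large
  red parts. What remains is determined by the gaps \<open>a\<^sub>1, \<dots>, a\<^sub>\<ell>\<close>, where \<open>a\<^sub>i\<close> counts the letters
  \<open>y\<close> between the \<open>i\<close>th \<open>z\<close> and the previous one, and has weight \<open>\<Sum>(a\<^sub>i + 2) (\<ell> + 1 - i)\<close>. The \<open>i\<close>th
  \<open>z\<close> is odd iff \<open>a\<^sub>i\<close> is odd, because the number of \<open>y\<close> and odd \<open>z\<close> up to and including any given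
  \<open>z\<close> is even. The odd gaps give the small red parts \<open>\<ell> + 1 - i\<close>, and the numbers
  \<open>2 (a\<^sub>i div 2) + 2\<close> are the successive differences of the green parts.
\<close>

section \<open>Words as sets of positions and lists of gaps\<close>

text \<open>Effect on the gaps of prepending a Y. The empty list stays empty, as a Y after the last
  Z belongs to no gap.\<close>

fun inc_hd :: "nat list \<Rightarrow> nat list" where
  "inc_hd [] = []"
| "inc_hd (a # as) = Suc a # as"

fun x_positions :: "letter list \<Rightarrow> nat set" where
  "x_positions [] = {}"
| "x_positions (X # u) = insert 0 (Suc ` x_positions u)"
| "x_positions (Y # u) = Suc ` x_positions u"
| "x_positions (Z # u) = Suc ` x_positions u"

fun gaps :: "letter list \<Rightarrow> nat list" where
  "gaps [] = []"
| "gaps (X # u) = gaps u"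
| "gaps (Y # u) = inc_hd (gaps u)"
| "gaps (Z # u) = 0 # gaps u"

lemma inc_hd_eq_Nil_iff [simp]: "inc_hd as = [] \<longleftrightarrow> as = []"
  by (cases as) auto

lemma length_inc_hd [simp]: "length (inc_hd as) = length as"
  by (cases as) auto

lemma inc_hd_neq_0_Cons [simp]: "inc_hd as \<noteq> 0 # bs" "0 # bs \<noteq> inc_hd as"
  by (cases as; simp)+

lemma inc_hd_inject [simp]: "inc_hd as = inc_hd bs \<longleftrightarrow> as = bs"
  by (cases as; cases bs) auto

lemma finite_x_positions [simp]: "finite (x_positions u)"
  by (induction u rule: x_positions.induct) auto

lemma card_x_positions: "card (x_positions u) = count_list u X"
  by (induction u rule: x_positions.induct) (auto simp: card_image)

lemma length_gaps: "length (gaps u) = count_list u Z"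
  by (induction u rule: gaps.induct) auto

lemma Nil_in_words [simp]: "[] \<in> words"
  by (simp add: words_def)

lemma Cons_in_words_iff: "c # u \<in> words \<longleftrightarrow> u \<in> words \<and> (c = Y \<longrightarrow> u \<noteq> [])"
  by (cases c) (auto simp: words_def)

text \<open>Words of Y alone leave no trace in positions or gaps; \<open>words\<close> contains only
  the empty one.\<close>

lemma x_positions_gaps_empty_iff:
  "u \<in> words \<Longrightarrow> x_positions u = {} \<and> gaps u = [] \<longleftrightarrow> u = []"
  by (induction u rule: gaps.induct) (auto simp: Cons_in_words_iff)

text \<open>The first letter of a nonempty word can be read off: X if 0 is a position, else Z if the
  gaps begin with 0, else Y.\<close>

lemma word_eqI:
  assumes "u \<in> words" "v \<in> words" "x_positions u = x_positions v" "gaps u = gaps v"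
  shows "u = v"
  using assms
proof (induction u arbitrary: v)
  case Nil
  then show ?case using x_positions_gaps_empty_iff[of v] by auto
next
  case (Cons c u)
  note prems = Cons.prems
  have "v \<noteq> []"
    using x_positions_gaps_empty_iff[OF prems(1)] prems(3,4) by auto
  then obtain d w where v: "v = d # w" by (cases v) auto
  have nz: "insert 0 (Suc ` A) \<noteq> Suc ` B" "Suc ` B \<noteq> insert 0 (Suc ` A)" for A B
    by blast+
  have ins: "insert 0 (Suc ` A) = insert 0 (Suc ` B) \<longleftrightarrow> A = B" for A B
    by blast
  have "c = d \<and> x_positions u = x_positions w \<and> gaps u = gaps w"
    using prems(3,4) unfolding v
    by (cases c; cases d) (simp_all add: nz ins inj_image_eq_iff)
  with prems(1,2) Cons.IH[of w] show ?case
    by (auto simp: v Cons_in_words_iff)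
qed

lemma finite_nat_set_eq_image_Suc:
  assumes "finite (B :: nat set)" "0 \<notin> B"
  obtains C where "finite C" "B = Suc ` C"
proof
  show "B = Suc ` ((\<lambda>b. b - 1) ` B)"
    unfolding image_image using assms(2)
    by (intro image_cong[of B B id, simplified]) (metis Suc_pred' gr0I id_apply)
qed (use assms(1) in simp)

lemma word_exists:
  assumes "finite B"
  shows "\<exists>u \<in> words. x_positions u = B \<and> gaps u = as"
  using assms
\<comment> \<open>The first letter is chosen by the same reading. \<open>Suc\<close> and
  \<open>length as\<close> make even a position 0 or a gap 0 count, so each letter lowers the
  measure.\<close>
proof (induction "sum Suc B + sum_list as + length as" arbitrary: B as rule: less_induct)
  case less
  have fin: "finite B" by fact
  have sum_Suc: "sum Suc (Suc ` C) = sum Suc C + card C" for C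
    by (simp add: sum.reindex o_def sum_Suc card_image)
  show ?case
  proof (cases "0 \<in> B")
    case True
    obtain C where C: "finite C" "B - {0} = Suc ` C"
      using finite_nat_set_eq_image_Suc[of "B - {0}"] fin by blast
    have B: "B = insert 0 (Suc ` C)" using C True by blast
    have "sum Suc C < sum Suc B"
      unfolding B using C(1) by (simp add: sum_Suc)
    then obtain u where "u \<in> words" "x_positions u = C" "gaps u = as"
      using less.hyps[of C as] C(1) by auto
    then show ?thesis
      by (intro bexI[of _ "X # u"]) (auto simp: B Cons_in_words_iff)
  next
    case False
    obtain C where C: "finite C" "B = Suc ` C"
      using finite_nat_set_eq_image_Suc[of B] fin False by blast
    have sum_le: "sum Suc B = sum Suc C + card C" by (simp add: C(2) sum_Suc)
    consider "\<exists>bs. as = 0 # bs" | "as = []" "B = {}" | "as = []" "B \<noteq> {}"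
      | a bs where "as = Suc a # bs"
      by (cases as) (auto, metis not0_implies_Suc)
    then show ?thesis
    proof cases
      case 1
      then obtain bs where as: "as = 0 # bs" by blast
      obtain u where "u \<in> words" "x_positions u = C" "gaps u = bs"
        using less.hyps[of C bs] C(1) sum_le by (auto simp: as)
      then show ?thesis
        by (intro bexI[of _ "Z # u"]) (auto simp: C(2) as Cons_in_words_iff)
    next
      case 2
      then show ?thesis by (intro bexI[of _ "[]"]) auto
    next
      case 3
      have "card C > 0" using 3 C by (simp add: card_gt_0_iff)
      then obtain u where u: "u \<in> words" "x_positions u = C" "gaps u = []"
        using less.hyps[of C "[]"] C(1) sum_le 3 by auto
      have "u \<noteq> []" using u(2) 3 C by auto
      then show ?thesis
        using u 3 by (intro bexI[of _ "Y # u"]) (auto simp: C(2) Cons_in_words_iff)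
    next
      case 4
      obtain u where u: "u \<in> words" "x_positions u = C" "gaps u = a # bs"
        using less.hyps[of C "a # bs"] C(1) sum_le by (auto simp: 4)
      have "u \<noteq> []" using u(3) by auto
      then show ?thesis
        using u by (intro bexI[of _ "Y # u"]) (auto simp: C(2) 4 Cons_in_words_iff)
    qed
  qed
qed

section \<open>Weight and odd letters\<close>

fun gap_weight :: "nat list \<Rightarrow> nat" where
  "gap_weight [] = 0"
| "gap_weight (a # as) = (a + 2) * Suc (length as) + gap_weight as"

lemma gap_weight_inc_hd [simp]: "gap_weight (inc_hd as) = gap_weight as + length as"
  by (cases as) auto

lemma sum_if_non_Y:
  "(\<Sum>i<length u. if u ! i \<noteq> Y then d else 0) = d * (count_list u X + count_list u Z)"
proof (induction u)
  case (Cons c u)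
  then show ?case
    by (cases c) (simp_all add: sum.lessThan_Suc_shift algebra_simps del: sum.lessThan_Suc)
qed simp

text \<open>A new first letter moves every X and Z one place right, and a Z also raises their counts
  of Z; the last summand is its own contribution.\<close>

lemma weight_Cons:
  "weight (c # u) = weight u + (if c = Z then 2 else 1) * (count_list u X + count_list u Z)
     + (if c = X then 1 else if c = Y then 0 else 2)"
proof -
  have card_Suc: "card {t. t \<le> Suc i \<and> (c # u) ! t = Z}
      = (if c = Z then 1 else 0) + card {t. t \<le> i \<and> u ! t = Z}" for i
  proof -
    have "{t. t \<le> Suc i \<and> (c # u) ! t = Z}
        = (if c = Z then {0} else {}) \<union> Suc ` {t. t \<le> i \<and> u ! t = Z}"
      by (auto simp: image_iff nth_Cons gr0_conv_Suc split: nat.splits) (metis not0_implies_Suc)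
    then show ?thesis
      by (auto simp: card_Un_disjoint card_image)
  qed
  have card_0: "card {t. t \<le> 0 \<and> (c # u) ! t = Z} = (if c = Z then 1 else 0)"
  proof -
    have "{t. t \<le> 0 \<and> (c # u) ! t = Z} = (if c = Z then {0} else {})"
      by auto
    then show ?thesis by simp
  qed
  have "weight (c # u) = (if c \<noteq> Y then 1 + card {t. t \<le> 0 \<and> (c # u) ! t = Z} else 0)
      + (\<Sum>i<length u. if u ! i \<noteq> Y
           then Suc (Suc i) + card {t. t \<le> Suc i \<and> (c # u) ! t = Z} else 0)"
    unfolding weight_def by (simp add: sum.lessThan_Suc_shift del: sum.lessThan_Suc)
  also have "\<dots> = (if c = X then 1 else if c = Y then 0 else 2)
      + (\<Sum>i<length u. (if u ! i \<noteq> Y then Suc i + card {t. t \<le> i \<and> u ! t = Z} else 0)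
           + (if u ! i \<noteq> Y then if c = Z then 2 else 1 else 0))"
    unfolding card_Suc card_0
    by (intro arg_cong2[where f = "(+)"] sum.cong refl) (cases c; simp)+
  also have "\<dots> = (if c = X then 1 else if c = Y then 0 else 2) + weight u
      + (if c = Z then 2 else 1) * (count_list u X + count_list u Z)"
    unfolding sum.distrib sum_if_non_Y weight_def by simp
  finally show ?thesis by simp
qed

lemma weight_Nil [simp]: "weight [] = 0"
  by (simp add: weight_def)

text \<open>Here \<open>p\<close> starts at 0, so \<open>Suc\<close> restores the position counted
  from 1. The induction prepends letters instead of deleting X: each shifts all positions, and a Z
  also lengthens the gaps.\<close>

lemma weight_eq:
  "weight u = (\<Sum>p \<in> x_positions u. p + Suc (length (gaps u))) + gap_weight (gaps u)"
proof (induction u)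
  case (Cons c u)
  have shift: "(\<Sum>p \<in> Suc ` B. p + m) = (\<Sum>p \<in> B. p + m) + card B" for B m
    by (simp add: sum.reindex o_def sum_Suc)
  show ?case
    by (cases c)
      (simp_all add: weight_Cons Cons.IH shift card_image card_x_positions length_gaps
        sum_Suc)
qed simp

text \<open>A scan whose flag is the parity of the number of Y and odd Z read so far. It is
  \<open>False\<close> after any Z: an even Z keeps an even count, an odd Z makes an odd count
  even.\<close>

fun count_odd_z :: "bool \<Rightarrow> letter list \<Rightarrow> nat" where
  "count_odd_z s [] = 0"
| "count_odd_z s (X # u) = count_odd_z s u"
| "count_odd_z s (Y # u) = count_odd_z (\<not> s) u"
| "count_odd_z s (Z # u) = of_bool s + count_odd_z False u"

text \<open>Downward induction from the end of \<open>u\<close>: the scan consumes suffixes, while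
  its flag depends on the prefix.\<close>

lemma count_odd_z_drop:
  assumes "i \<le> length u"
  shows "count_odd_z (odd (card {t. t < i \<and> (u ! t = Y \<or> odd_z u t)})) (drop i u)
    = card {t. i \<le> t \<and> t < length u \<and> odd_z u t}"
  using assms
proof (induction i rule: inc_induct)
  case base
  then show ?case by auto
next
  case (step i)
  let ?T = "\<lambda>i. {t. t < i \<and> (u ! t = Y \<or> odd_z u t)}"
  have T: "?T (Suc i) = (if u ! i = Y \<or> odd_z u i then insert i (?T i) else ?T i)"
    by (auto simp: less_Suc_eq)
  have cardT: "card (?T (Suc i)) = (if u ! i = Y \<or> odd_z u i then Suc (card (?T i)) else card (?T i))"
    unfolding T by auto
  have "{t. i \<le> t \<and> t < length u \<and> odd_z u t}
      = (if odd_z u i then {i} else {}) \<union> {t. Suc i \<le> t \<and> t < length u \<and> odd_z u t}"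
    using step.hyps by (auto simp: Suc_le_eq le_less)
  then have card: "card {t. i \<le> t \<and> t < length u \<and> odd_z u t}
      = of_bool (odd_z u i) + card {t. Suc i \<le> t \<and> t < length u \<and> odd_z u t}"
    by (auto simp: card_Un_disjoint)
  have drop: "drop i u = u ! i # drop (Suc i) u"
    using step.hyps by (simp add: Cons_nth_drop_Suc)
  have oz: "odd_z u i \<longleftrightarrow> u ! i = Z \<and> odd (card (?T i))"
    by (subst odd_z.simps) simp
  show ?case
    unfolding card drop using step.IH
    unfolding cardT by (cases "u ! i"; cases "odd (card (?T i))") (simp_all add: oz)
qed

text \<open>An odd initial flag acts like one extra Y in front, hence \<open>inc_hd\<close>; two
  extra Y cancel. Both claims go together because Y flips the flag.\<close>

lemma count_odd_z_gaps:
  "count_odd_z False u = length (filter odd (gaps u))"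
  "count_odd_z True u = length (filter odd (inc_hd (gaps u)))"
proof (induction u)
  case (Cons c u)
  case 1
  show ?case using Cons.IH by (cases c) auto
  case 2
  have "length (filter odd (inc_hd (inc_hd as))) = length (filter odd as)" for as
    by (cases as) auto
  then show ?case using Cons.IH by (cases c) auto
qed auto

lemma card_odd_z: "card {i. i < length u \<and> odd_z u i} = length (filter odd (gaps u))"
  using count_odd_z_drop[of 0 u] by (simp add: count_odd_z_gaps)

text \<open>Even a prepended Y costs weight, since a nonempty word of \<open>words\<close> contains
  an X or Z to be shifted. This gives finiteness.\<close>

lemma length_le_weight: "u \<in> words \<Longrightarrow> length u \<le> weight u"
proof (induction u)
  case (Cons c u)
  then have "u \<in> words" "c = Y \<longrightarrow> u \<noteq> []" by (auto simp: Cons_in_words_iff)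
  moreover have "count_list u X + count_list u Z \<noteq> 0" if "u \<in> words" "u \<noteq> []"
    using that last_in_set[of u] by (auto simp: words_def count_list_0_iff simp del: last_in_set)
  ultimately show ?case
    using Cons.IH by (cases c) (auto simp: weight_Cons)
qed simp

lemma finite_\<W>: "finite (\<W> n k l j)"
proof (rule finite_subset)
  show "\<W> n k l j \<subseteq> {u. set u \<subseteq> {X, Y, Z} \<and> length u \<le> n}"
    using length_le_weight letter.exhaust by (auto simp: \<W>_def)
qed (rule finite_lists_length_le, simp)

section \<open>Gaps as small red parts and green parts\<close>

fun small_red :: "nat list \<Rightarrow> nat set" where
  "small_red [] = {}"
| "small_red (a # as) = (if odd a then insert (Suc (length as)) (small_red as) else small_red as)"

text \<open>Partial sums of the differences \<open>2 * (a div 2) + 2\<close>, smallest part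
  first.\<close>

fun green :: "nat list \<Rightarrow> nat set" where
  "green [] = {}"
| "green (a # as) = insert (2 * (a div 2) + 2) ((+) (2 * (a div 2) + 2) ` green as)"

lemma small_red_subset: "small_red as \<subseteq> {1..length as}"
  by (induction as) auto

lemma finite_small_red [simp]: "finite (small_red as)"
  by (rule finite_subset[OF small_red_subset]) simp

lemma Suc_length_notin_small_red [simp]: "Suc (length as) \<notin> small_red as"
  using small_red_subset[of as] by auto

lemma card_small_red: "card (small_red as) = length (filter odd as)"
  by (induction as) auto

lemma finite_green [simp]: "finite (green as)"
  by (induction as) auto

lemma green_pos_even: "g \<in> green as \<Longrightarrow> g > 0 \<and> even g"
  by (induction as arbitrary: g) auto

lemma zero_notin_green [simp]: "0 \<notin> green as"
  using green_pos_even by blast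

lemma card_green: "card (green as) = length as"
  by (induction as) (auto simp: card_insert_if card_image inj_on_def)

text \<open>The head difference enters all \<open>Suc (length as)\<close> green parts; the remaining
  \<open>a mod 2\<close> of \<open>a + 2\<close> is covered by the red part of size
  \<open>Suc (length as)\<close>.\<close>

lemma sum_small_red_green: "\<Sum>(small_red as) + \<Sum>(green as) = gap_weight as"
proof (induction as)
  case (Cons a as)
  let ?g = "2 * (a div 2) + 2"
  have "\<Sum>((+) ?g ` green as) = length as * ?g + \<Sum>(green as)"
    by (subst sum.reindex) (auto simp: inj_on_def sum.distrib card_green sum_Suc)
  then have "\<Sum>(green (a # as)) = Suc (length as) * ?g + \<Sum>(green as)"
    by (subst green.simps, subst sum.insert) auto
  moreover have "\<Sum>(small_red (a # as)) = Suc (length as) * (a mod 2) + \<Sum>(small_red as)"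
    by (simp add: odd_iff_mod_2_eq_one)
  moreover have "a + 2 = ?g + a mod 2" by simp
  ultimately show ?case
    using Cons.IH by (simp only: gap_weight.simps) (simp only: algebra_simps)
qed simp

text \<open>The least green part determines \<open>a div 2\<close>, and the presence of
  \<open>Suc (length as)\<close> the parity of \<open>a\<close>; the tails follow.\<close>

lemma gaps_eqI:
  assumes "length as = length bs" "small_red as = small_red bs" "green as = green bs"
  shows "as = bs"
  using assms
proof (induction rule: list_induct2)
  case (Cons a as b bs)
  let ?g = "\<lambda>a. 2 * (a div 2) + 2 :: nat"
  have "Min (green (a # as)) = ?g a" for a as
    by (rule Min_eqI) auto
  then have g: "?g a = ?g b" using Cons.prems(2) by metis
  have "odd a \<longleftrightarrow> Suc (length as) \<in> small_red (a # as)" by simp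
  also have "\<dots> \<longleftrightarrow> odd b" unfolding Cons.prems(1) using Cons.hyps by simp
  finally have ab: "a = b" using g by presburger
  have "green as = (\<lambda>x. x - ?g a) ` (green (a # as) - {?g a})" for a as
    by (auto simp: image_iff)
  then have "green as = green bs" using Cons.prems(2) ab by metis
  moreover have "small_red as = small_red (a # as) - {Suc (length as)}" for a as
    by auto
  then have "small_red as = small_red bs" using Cons.prems(1) Cons.hyps by metis
  ultimately show ?case using Cons.IH ab by simp
qed simp

lemma gaps_exist:
  assumes "R \<subseteq> {1..l}" "finite G" "card G = l" "\<And>g. g \<in> G \<Longrightarrow> g > 0 \<and> even g"
  shows "\<exists>as. length as = l \<and> small_red as = R \<and> green as = G"
  using assms
proof (induction l arbitrary: R G)
  case (Suc l)
  have "G \<noteq> {}" using Suc.prems by auto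
  define m where "m = Min G"
  have m: "m \<in> G" "\<And>g. g \<in> G \<Longrightarrow> m \<le> g"
    using Suc.prems(2) \<open>G \<noteq> {}\<close> by (auto simp: m_def)
  have m_even: "m > 0" "even m" using Suc.prems(4)[OF m(1)] by auto
  define H where "H = (\<lambda>g. g - m) ` (G - {m})"
  have "inj_on (\<lambda>g. g - m) (G - {m})"
    using m by (intro inj_onI) (metis Diff_iff eq_diff_iff)
  then have "card H = l" using Suc.prems m by (simp add: H_def card_image)
  moreover have "h > 0 \<and> even h" if "h \<in> H" for h
    using that m(2) m_even(2) Suc.prems(4) by (force simp: H_def le_less)
  moreover have "R - {Suc l} \<subseteq> {1..l}" "finite H"
    using Suc.prems by (auto simp: H_def le_Suc_eq)
  ultimately obtain as where as: "length as = l" "small_red as = R - {Suc l}" "green as = H"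
    using Suc.IH[of "R - {Suc l}" H] by blast
  \<comment> \<open>The least green part fixes the gap up to parity, which membership of
    \<open>Suc l\<close> in \<open>R\<close> settles. The subtraction is exact since
    \<open>m\<close> is positive and even.\<close>
  define a where "a = m - 2 + of_bool (Suc l \<in> R)"
  have "m \<ge> 2" using m_even by (auto elim!: evenE)
  then have a: "2 * (a div 2) + 2 = m" "odd a \<longleftrightarrow> Suc l \<in> R"
    using m_even by (auto simp: a_def)
  have "(+) m ` H = G - {m}"
    using m by (force simp: H_def image_image image_iff)
  then have "green (a # as) = G" using m(1) by (auto simp only: green.simps a as)
  moreover have "small_red (a # as) = R" using as a(2) by auto
  ultimately show ?case using as(1) by (intro exI[of _ "a # as"]) simp
qed auto

section \<open>Two-color partitions as pairs of sets\<close>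

definition partition_of :: "nat set \<Rightarrow> nat set \<Rightarrow> (nat \<times> color) multiset" where
  "partition_of R G = mset_set (R \<times> {Red} \<union> G \<times> {Green})"

lemma count_parts_of_color: "count (parts_of_color c P) a = count P (a, c)"
  by (induction P) (auto simp: parts_of_color_def)

lemma parts_of_partition_of:
  assumes "finite R" "finite G"
  shows "parts_of_color Red (partition_of R G) = mset_set R"
    and "parts_of_color Green (partition_of R G) = mset_set G"
  using assms by (auto intro!: multiset_eqI
      simp: count_parts_of_color partition_of_def count_mset_set')

lemma sum_partition_of:
  assumes "finite R" "finite G"
  shows "(\<Sum>p \<in># partition_of R G. fst p) = \<Sum>R + \<Sum>G"
proof -
  have "(\<Sum>p \<in># partition_of R G. fst p) = (\<Sum>p \<in> R \<times> {Red} \<union> G \<times> {Green}. fst p)"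
    by (simp add: partition_of_def sum_unfold_sum_mset)
  also have "\<dots> = (\<Sum>p \<in> R \<times> {Red}. fst p) + (\<Sum>p \<in> G \<times> {Green}. fst p)"
    using assms by (intro sum.union_disjoint) auto
  also have "\<dots> = \<Sum>R + \<Sum>G"
    by (simp add: sum.cartesian_product')
  finally show ?thesis .
qed

lemma partition_of_in_\<A>_iff:
  assumes "finite R" "finite G"
  shows "partition_of R G \<in> \<A> n k l j \<longleftrightarrow> 0 \<notin> R \<and> 0 \<notin> G \<and> \<Sum>R + \<Sum>G = n \<and> card R = k + j \<and>
    card G = l \<and> (\<forall>g \<in> G. even g) \<and> card {a \<in> R. a > l} = k"
proof -
  have "(\<forall>p \<in># partition_of R G. fst p > 0) \<longleftrightarrow> 0 \<notin> R \<and> 0 \<notin> G"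
    using assms by (force simp: partition_of_def intro: gr0I)
  moreover have "pairwise_distinct (mset_set S)" for S
    by (cases "finite S") (auto simp: pairwise_distinct_def)
  ultimately show ?thesis
    using assms
    by (auto simp: \<A>_def two_color_partitions_def parts_of_partition_of sum_partition_of)
qed

text \<open>Distinctness within each color makes all multiplicities 0 or 1, so the two sets of parts
  determine the partition.\<close>

lemma \<A>_cases:
  assumes "P \<in> \<A> n k l j"
  obtains R G where "finite R" "finite G" "P = partition_of R G"
proof
  show "P = partition_of (set_mset (parts_of_color Red P)) (set_mset (parts_of_color Green P))"
  proof (rule multiset_eqI)
    fix p :: "nat \<times> color"
    obtain a c where p: "p = (a, c)" by fastforce
    have "pairwise_distinct (parts_of_color c P)"
      using assms by (cases c) (auto simp: \<A>_def)
    then have "count P p = of_bool (a \<in># parts_of_color c P)"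
      by (auto simp: p pairwise_distinct_def simp flip: count_parts_of_color not_in_iff)
    then show "count P p = count (partition_of (set_mset (parts_of_color Red P))
        (set_mset (parts_of_color Green P))) p"
      by (cases c) (auto simp: p partition_of_def count_mset_set')
  qed
qed simp_all

section \<open>The bijection\<close>

text \<open>As \<open>p\<close> starts at 0, the shifted positions range over the numbers above
  \<open>length (gaps u)\<close>, clear of the small parts.\<close>

definition red :: "letter list \<Rightarrow> nat set" where
  "red u = small_red (gaps u) \<union> (\<lambda>p. p + Suc (length (gaps u))) ` x_positions u"

lemma finite_red [simp]: "finite (red u)"
  by (simp add: red_def)

lemma red_small: "{r \<in> red u. r \<le> length (gaps u)} = small_red (gaps u)"
  using small_red_subset[of "gaps u"] by (auto simp: red_def)

lemma red_large:
  "{r \<in> red u. r > length (gaps u)} = (\<lambda>p. p + Suc (length (gaps u))) ` x_positions u"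
  using small_red_subset[of "gaps u"] by (auto simp: red_def)

lemma small_large_disjoint:
  "small_red (gaps u) \<inter> (\<lambda>p. p + Suc (length (gaps u))) ` x_positions u = {}"
  using small_red_subset[of "gaps u"] by auto

lemma sum_red_green: "\<Sum>(red u) + \<Sum>(green (gaps u)) = weight u"
proof -
  have "\<Sum>(red u) = \<Sum>(small_red (gaps u)) + (\<Sum>p \<in> x_positions u. p + Suc (length (gaps u)))"
    unfolding red_def
    by (subst sum.union_disjoint) (use small_large_disjoint in \<open>auto simp: sum.reindex inj_on_def\<close>)
  then show ?thesis
    using sum_small_red_green[of "gaps u"] by (simp add: weight_eq)
qed

lemma card_red: "card (red u) = length (filter odd (gaps u)) + count_list u X"
  unfolding red_def
  by (subst card_Un_disjoint)
    (use small_large_disjoint in \<open>auto simp: card_image inj_on_def card_small_red card_x_positions\<close>)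

lemma card_red_large: "card {r \<in> red u. r > length (gaps u)} = count_list u X"
  unfolding red_large by (simp add: card_image inj_on_def card_x_positions)

text \<open>The equivalence serves twice: images lie in \<open>\<A>\<close>, and preimages found in
  \<open>words\<close> lie in \<open>\<W>\<close>.\<close>

lemma partition_of_red_green_in_\<A>_iff:
  assumes "u \<in> words"
  shows "partition_of (red u) (green (gaps u)) \<in> \<A> n k l j \<longleftrightarrow> u \<in> \<W> n k l j"
proof -
  have "0 \<notin> red u"
    using small_red_subset[of "gaps u"] by (auto simp: red_def)
  then show ?thesis
    using assms green_pos_even[of _ "gaps u"] card_red_large[of u]
    by (auto simp: partition_of_in_\<A>_iff \<W>_def sum_red_green card_red card_green
        card_odd_z length_gaps)
qed

lemma partition_of_inject:
  assumes "partition_of R G = partition_of R' G'" "finite R" "finite G" "finite R'" "finite G'"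
  shows "R = R' \<and> G = G'"
  using assms parts_of_partition_of[of R G] parts_of_partition_of[of R' G']
  by (metis finite_set_mset_mset_set)

lemma bij_betw_\<W>_\<A>:
  "bij_betw (\<lambda>u. partition_of (red u) (green (gaps u))) (\<W> n k l j) (\<A> n k l j)"
proof (rule bij_betw_imageI)
  show "inj_on (\<lambda>u. partition_of (red u) (green (gaps u))) (\<W> n k l j)"
  proof (rule inj_onI)
    fix u v
    assume u: "u \<in> \<W> n k l j" and v: "v \<in> \<W> n k l j"
      and "partition_of (red u) (green (gaps u)) = partition_of (red v) (green (gaps v))"
    then have eq: "red u = red v" "green (gaps u) = green (gaps v)"
      using partition_of_inject by auto
    \<comment> \<open>Equal numbers of Z give the same threshold between small and large red
      parts.\<close>
    have len: "length (gaps u) = length (gaps v)"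
      using u v by (auto simp: \<W>_def length_gaps)
    have "gaps u = gaps v"
      using red_small[of u] red_small[of v] eq len by (intro gaps_eqI) auto
    moreover have "x_positions u = x_positions v"
      using red_large[of u] red_large[of v] eq(1) len
      by (simp add: inj_image_eq_iff inj_on_def)
    ultimately show "u = v"
      using u v by (intro word_eqI) (auto simp: \<W>_def)
  qed
  show "(\<lambda>u. partition_of (red u) (green (gaps u))) ` \<W> n k l j = \<A> n k l j"
  proof (intro equalityI subsetI)
    fix P assume "P \<in> (\<lambda>u. partition_of (red u) (green (gaps u))) ` \<W> n k l j"
    then show "P \<in> \<A> n k l j"
      using partition_of_red_green_in_\<A>_iff by (auto simp: \<W>_def)
  next
    fix P assume P: "P \<in> \<A> n k l j"
    then obtain R G where RG: "finite R" "finite G" "P = partition_of R G"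
      by (rule \<A>_cases)
    have props: "0 \<notin> R" "0 \<notin> G" "card G = l" "\<forall>g \<in> G. even g"
      using P RG by (auto simp: partition_of_in_\<A>_iff)
    have "{r \<in> R. r \<le> l} \<subseteq> {1..l}"
      using props(1) by (auto simp: Suc_le_eq intro: gr0I)
    moreover have "g > 0 \<and> even g" if "g \<in> G" for g
      using that props(2,4) by (auto intro: gr0I)
    ultimately obtain as where as: "length as = l" "small_red as = {r \<in> R. r \<le> l}" "green as = G"
      using gaps_exist[of "{r \<in> R. r \<le> l}" l G] RG(2) props(3) by blast
    \<comment> \<open>Undoes the shift in \<open>red\<close>; the subtraction is exact on parts
      above \<open>l\<close>.\<close>
    obtain u where u: "u \<in> words" "x_positions u = (\<lambda>r. r - Suc l) ` {r \<in> R. r > l}" "gaps u = as"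
      using word_exists[of "(\<lambda>r. r - Suc l) ` {r \<in> R. r > l}" as] RG(1) by auto
    have "(\<lambda>p. p + Suc l) ` x_positions u = {r \<in> R. r > l}"
      unfolding u(2) by (force simp: image_image image_iff)
    then have "red u = R" using u as by (auto simp: red_def)
    then have "P = partition_of (red u) (green (gaps u))" using RG u as by simp
    then show "P \<in> (\<lambda>u. partition_of (red u) (green (gaps u))) ` \<W> n k l j"
      using P partition_of_red_green_in_\<A>_iff[OF u(1)] by blast
  qed
qed

theorem theorem2p2:
  fixes n k l j :: nat
  assumes "j \<le> l"
  shows "(\<exists>f. bij_betw f (\<W> n k l j) (\<A> n k l j)) \<and>
    finite (\<W> n k l j) \<and> finite (\<A> n k l j) \<and> card (\<W> n k l j) = card (\<A> n k l j)"
  using bij_betw_\<W>_\<A> finite_\<W> bij_betw_finite bij_betw_same_card by blast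

end
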